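(* Let $\dot G$ be an $(n,r)$-SR2SE with underlying graph $G$. Then: (i) $n\geqslant \binom{r+1}{2}+1$, and in case of equality $G$ is a strongly regular graph with parameters $(n,r,0,2)$; (ii) $\dot G$ contains exactly $\frac{n}{4}\binom{r}{2}$ quadrangles (4-cycles); (iii) if $n\equiv 2 \pmod 4$, then (a) $r$ is a sum of two squares of integers and (b) $r(r-1)\equiv 0\pmod 4$; (iv) the sum of the cubes of the eigenvalues of the (unsigned) graph $G$ is $0$, and the sum of the fourth powers of the eigenvalues of $G$ is $nr(3r-2)$.
   Context: A signed graph $\dot G=(G,\sigma)$ consists of a simple graph $G$ (the underlying graph) and $\sigma:E(G)\to\{1,-1\}$; its adjacency matrix is that of $G$ with entries of negative edges replaced by $-1$, and its eigenvalues are those of this matrix. A signed $(0,2)$-graph is a connected signed graph in which any two distinct vertices have $0$ or $2$ common neighbours; a signed rectagraph is a triangle-free signed $(0,2)$-graph. An SR2SE is a signed rectagraph whose spectrum consists of exactly two distinct eigenvalues $\pm\lambda$; an $(n,r)$-SR2SE is one with $n$ vertices that is regular of degree $r$. A strongly regular graph with parameters $(n,r,a,c)$ is an $n$-vertex $r$-regular graph in which adjacent vertices have $a$ common neighbours and distinct non-adjacent vertices have $c$ common neighbours. *)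

theory Defs
  imports
    "HOL-Number_Theory.Cong"
    "Jordan_Normal_Form.Spectral_Radius"
    "Graph_Theory.Graph_Theory"
begin

text \<open>
  Simple graphs are the finite, loop-free, symmetric digraphs of the locale
  \<^locale>\<open>pair_graph\<close>: an edge $uv$ is represented by the two arcs $(u,v)$ and $(v,u)$, and the
  degree of a vertex is its out-degree. A signature assigns a sign to the unordered pair
  $\{u,v\}$; its values on pairs that are not edges are irrelevant.
\<close>

locale signed_graph = pair_graph G for G :: "'a pair_pre_digraph" +
  fixes \<sigma> :: "'a set \<Rightarrow> int"
  assumes sign: "(u, v) \<in> parcs G \<Longrightarrow> \<sigma> {u, v} \<in> {1, -1}"

definition common_neighbours :: "'a pair_pre_digraph \<Rightarrow> 'a \<Rightarrow> 'a \<Rightarrow> 'a set" where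
  "common_neighbours G u v = {w. (u, w) \<in> parcs G \<and> (v, w) \<in> parcs G}"

definition triangle_free :: "'a pair_pre_digraph \<Rightarrow> bool" where
  "triangle_free G \<longleftrightarrow>
     \<not> (\<exists>u v w. (u, v) \<in> parcs G \<and> (v, w) \<in> parcs G \<and> (w, u) \<in> parcs G)"

definition regular_of_degree :: "'a pair_pre_digraph \<Rightarrow> nat \<Rightarrow> bool" where
  "regular_of_degree G r \<longleftrightarrow> (\<forall>v \<in> pverts G. out_degree (with_proj G) v = r)"

definition strongly_regular ::
    "'a pair_pre_digraph \<Rightarrow> nat \<Rightarrow> nat \<Rightarrow> nat \<Rightarrow> nat \<Rightarrow> bool" where
  "strongly_regular G n r a c \<longleftrightarrow>
     pair_graph G \<and> card (pverts G) = n \<and> regular_of_degree G r \<and>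
     (\<forall>u \<in> pverts G. \<forall>v \<in> pverts G. u \<noteq> v \<longrightarrow>
        card (common_neighbours G u v) = (if (u, v) \<in> parcs G then a else c))"

text \<open>
  A quadrangle is a (not necessarily induced) subgraph that is a 4-cycle; it is identified with
  its set of edges, so that the choice of a starting vertex and of a direction does not matter.
\<close>

definition quadrangles :: "'a pair_pre_digraph \<Rightarrow> 'a set set set" where
  "quadrangles G = {{{a, b}, {b, c}, {c, d}, {d, a}} | a b c d.
     distinct [a, b, c, d] \<and>
     (a, b) \<in> parcs G \<and> (b, c) \<in> parcs G \<and> (c, d) \<in> parcs G \<and> (d, a) \<in> parcs G}"

text \<open>
  The rows and columns of an adjacency matrix are labelled by an arbitrary but fixed enumeration
  of the vertices. Another enumeration gives a matrix that is similar by a permutation, hence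
  has the same characteristic polynomial and the same spectrum.
\<close>

definition vertex_list :: "'a pair_pre_digraph \<Rightarrow> 'a list" where
  "vertex_list G = (SOME vs. distinct vs \<and> set vs = pverts G)"

lemma vertex_list:
  assumes "finite (pverts G)"
  shows "distinct (vertex_list G)" "set (vertex_list G) = pverts G"
    "length (vertex_list G) = card (pverts G)"
proof -
  have "\<exists>vs. distinct vs \<and> set vs = pverts G"
    using finite_distinct_list[OF assms] by blast
  then have *: "distinct (vertex_list G) \<and> set (vertex_list G) = pverts G"
    unfolding vertex_list_def by (rule someI_ex)
  then show "distinct (vertex_list G)" "set (vertex_list G) = pverts G" by auto
  from * show "length (vertex_list G) = card (pverts G)" by (metis distinct_card)
qed

text \<open>
  The matrices are taken over the complex numbers so that every root of the characteristic
  polynomial counts as an eigenvalue; as the matrices are real symmetric, all of them are real.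
\<close>

definition signed_adjacency_matrix ::
    "'a pair_pre_digraph \<Rightarrow> ('a set \<Rightarrow> int) \<Rightarrow> complex mat" where
  "signed_adjacency_matrix G \<sigma> =
     (let vs = vertex_list G in
      mat (length vs) (length vs)
        (\<lambda>(i, j). if (vs ! i, vs ! j) \<in> parcs G then of_int (\<sigma> {vs ! i, vs ! j}) else 0))"

definition adjacency_matrix :: "'a pair_pre_digraph \<Rightarrow> complex mat" where
  "adjacency_matrix G =
     (let vs = vertex_list G in
      mat (length vs) (length vs)
        (\<lambda>(i, j). if (vs ! i, vs ! j) \<in> parcs G then 1 else 0))"

text \<open>Each eigenvalue is counted with its multiplicity as a root of the characteristic
  polynomial.\<close>

definition eigenvalue_power_sum :: "complex mat \<Rightarrow> nat \<Rightarrow> complex" where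
  "eigenvalue_power_sum A k =
     (\<Sum>\<mu> \<in> spectrum A. of_nat (Polynomial.order \<mu> (char_poly A)) * \<mu> ^ k)"

locale signed_02_graph = signed_graph +
  assumes connected: "Digraph_Component.connected (with_proj G)"
    and zero_or_two: "\<lbrakk>u \<in> pverts G; v \<in> pverts G; u \<noteq> v\<rbrakk> \<Longrightarrow>
      card (common_neighbours G u v) \<in> {0, 2}"

locale signed_rectagraph = signed_02_graph +
  assumes triangle_free: "triangle_free G"

locale SR2SE = signed_rectagraph +
  assumes two_symmetric_eigenvalues:
    "\<exists>\<mu>. \<mu> \<noteq> 0 \<and> spectrum (signed_adjacency_matrix G \<sigma>) = {\<mu>, - \<mu>}"

definition nr_SR2SE :: "'a pair_pre_digraph \<Rightarrow> ('a set \<Rightarrow> int) \<Rightarrow> nat \<Rightarrow> nat \<Rightarrow> bool" where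
  "nr_SR2SE G \<sigma> n r \<longleftrightarrow> SR2SE G \<sigma> \<and> card (pverts G) = n \<and> regular_of_degree G r"

end

theory Submission
  imports Defs
begin

text \<open>
  Let $S$ be the signed adjacency matrix. Comparing traces of $S^k$ with power sums of $\pm\mu$
  for $k = 0, 1, 2$ gives equal multiplicities $m = n/2$ and $\mu^2 = r$; for $k = 4$ it says that
  the diagonal of $S^2$ already exhausts its squared Frobenius norm, so $S^2 = rI$ without any
  appeal to the spectral theorem. Parts (i), (ii), (iv) and (iii)(b) are then counts of walks of
  length two.

  For (iii)(a), the multiplicity $m$ of $\mu$ forces the coefficient of $t^m$ in the characteristic
  polynomial of $S - \mu I$ not to vanish, so some $m$-subset $I$ of the vertices has
  $\det(\mu I - A) \neq 0$ for $A = S[I, I]$. With the square block $B = S[I, I^c]$,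
  $S^2 = rI$ yields $BB^T = rI - A^2 = (\mu I - A)(\mu I + A)$. If $f$ is the characteristic
  polynomial of $A$ and $f(\pm\mu) = g \pm \mu h$ with integers $g, h$, then for odd $m$ taking
  determinants gives $\det(B)^2 = rh^2 - g^2$ with $h \neq 0$. So $r$ times a nonzero square is a
  sum of two squares, and hence so is $r$.
\<close>

section \<open>Sums of two squares\<close>

text \<open>Thue's argument: two points of the box $[0, \sqrt r]^2$ have the same value of
  $ax - by$ modulo $r$, and their difference $(x, y)$ satisfies $x^2 + y^2 \in \{r, 2r\}$.\<close>

lemma sum_of_two_squares_if_coprime:
  fixes r a b :: int
  assumes r: "r > 0" and ab: "coprime a b" and dvd: "r dvd a ^ 2 + b ^ 2"
  shows "\<exists>x y. r = x ^ 2 + y ^ 2"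
proof -
  \<comment> \<open>A common divisor of b and r also divides a^2, hence is a unit. This later
    cancels \<open>b ^ 2\<close> from a multiple of r.\<close>
  have br: "coprime (b ^ 2) r"
  proof -
    let ?d = "gcd b r"
    have "?d dvd (a ^ 2 + b ^ 2) - b ^ 2"
      using dvd by (intro dvd_diff) (auto simp: power2_eq_square intro: dvd_trans)
    then have "?d dvd a ^ 2" by simp
    moreover have "coprime (a ^ 2) b" using ab by simp
    ultimately have "is_unit ?d" by (meson coprime_common_divisor gcd_dvd1)
    then have "coprime b r" by (simp add: coprime_iff_gcd_eq_1)
    then show ?thesis by simp
  qed
  define k where "k = \<lfloor>sqrt (real_of_int r)\<rfloor>"
  have k0: "k \<ge> 0" using r by (simp add: k_def)
  have "real_of_int k ^ 2 \<le> sqrt (real_of_int r) ^ 2"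
    using k0 by (intro power_mono) (auto simp: k_def)
  then have kr: "k ^ 2 \<le> r" using r by (simp flip: of_int_power)
  have "sqrt (real_of_int r) ^ 2 < real_of_int (k + 1) ^ 2"
    using r by (intro power_strict_mono) (auto simp: k_def)
  then have rk: "r < (k + 1) ^ 2" using r by (simp flip: of_int_power del: of_int_add)
  define f where "f = (\<lambda>(x, y). (a * x - b * y) mod r)"
  \<comment> \<open>Pigeonhole: the box has (k + 1)^2 > r points, while \<open>f\<close> takes at
    most r values.\<close>
  have "card ({0..k} \<times> {0..k}) = nat ((k + 1) ^ 2)"
    using k0 by (simp add: card_cartesian_product power2_eq_square nat_mult_distrib)
  moreover have "nat r < nat ((k + 1) ^ 2)" using r rk by linarith
  ultimately have "card {0..<r} < card ({0..k} \<times> {0..k})" by simp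
  moreover have "f ` ({0..k} \<times> {0..k}) \<subseteq> {0..<r}" using r by (auto simp: f_def)
  ultimately have "\<not> inj_on f ({0..k} \<times> {0..k})"
    by (metis card_inj_on_le finite_atLeastLessThan_int not_less)
  then obtain x1 y1 x2 y2 where xy: "x1 \<in> {0..k}" "y1 \<in> {0..k}" "x2 \<in> {0..k}" "y2 \<in> {0..k}"
    and ne: "(x1, y1) \<noteq> (x2, y2)" and eq: "f (x1, y1) = f (x2, y2)"
    by (auto simp: inj_on_def)
  define x y where "x = x1 - x2" and "y = y1 - y2"
  have bound: "x ^ 2 \<le> k ^ 2" "y ^ 2 \<le> k ^ 2"
    using xy by (auto simp: x_def y_def abs_le_square_iff[symmetric])
  have pos: "x ^ 2 + y ^ 2 > 0" using ne by (auto simp: x_def y_def sum_power2_gt_zero_iff)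
  have "r dvd (a * x1 - b * y1) - (a * x2 - b * y2)"
    using eq by (simp add: f_def mod_eq_dvd_iff)
  then have "r dvd a * x - b * y" by (simp add: x_def y_def algebra_simps)
  \<comment> \<open>The conjugate factor turns the linear congruence into one between squares;
    subtracting it from (a^2 + b^2) x^2 leaves b^2 (x^2 + y^2).\<close>
  then have "r dvd (a * x - b * y) * (a * x + b * y)" by simp
  with dvd have "r dvd (a ^ 2 + b ^ 2) * x ^ 2 - (a * x - b * y) * (a * x + b * y)"
    by (intro dvd_diff) auto
  also have "\<dots> = b ^ 2 * (x ^ 2 + y ^ 2)" by (simp add: algebra_simps power2_eq_square)
  finally have "r dvd x ^ 2 + y ^ 2" using br coprime_dvd_mult_right_iff coprime_commute by metis
  then obtain q where q: "x ^ 2 + y ^ 2 = r * q" by blast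
  have "q > 0" using pos q r by (simp add: zero_less_mult_iff)
  moreover have "r * q \<le> r * 2" using q bound kr by linarith
  then have "q \<le> 2" using r by simp
  ultimately consider "q = 1" | "q = 2" by linarith
  then show ?thesis
  proof cases
    case 1
    then show ?thesis using q by auto
  next
    case 2
    \<comment> \<open>Here x^2 + y^2 = 2r although both squares are at most k^2 \<le> r, so k^2 = r
      and r is itself a square.\<close>
    then have "r = k ^ 2 + 0 ^ 2" using q bound kr by auto
    then show ?thesis by blast
  qed
qed

text \<open>Descent on the value r h^2. If g and d are coprime, Thue's argument applies, since r
  divides g^2 + d^2. Otherwise a common prime p has p^2 dividing r h^2: either p divides h and
  cancels there, or p^2 divides r, and a representation of r / p^2 is scaled back by p.\<close>

lemma sum_of_two_squares_if_mult_square: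
  fixes r h g d :: int
  assumes "r > 0" "h \<noteq> 0" "r * h ^ 2 = g ^ 2 + d ^ 2"
  shows "\<exists>x y. r = x ^ 2 + y ^ 2"
  using assms
proof (induction "nat (r * h ^ 2)" arbitrary: r h g d rule: less_induct)
  case less
  show ?case
  proof (cases "coprime g d")
    case True
    then show ?thesis
      using sum_of_two_squares_if_coprime less.prems by (metis dvd_triv_left)
  next
    case False
    then have "\<not> is_unit (gcd g d)" using is_unit_gcd by blast
    moreover have "gcd g d \<noteq> 0" using less.prems by auto
    ultimately obtain p where p: "prime p" "p dvd gcd g d"
      using prime_divisor_exists by blast
    then obtain g' d' where gd: "g = p * g'" "d = p * d'" by (auto elim!: dvdE)
    have p1: "p > 1" using p(1) by (rule prime_gt_1_int)
    have eq: "r * h ^ 2 = p ^ 2 * (g' ^ 2 + d' ^ 2)"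
      using less.prems(3) by (simp add: gd algebra_simps power_mult_distrib)
    have "r * h ^ 2 > 0" using less.prems(1,2) by simp
    then have pos: "g' ^ 2 + d' ^ 2 > 0" unfolding eq using p1 by (simp add: zero_less_mult_iff)
    have small: "nat (g' ^ 2 + d' ^ 2) < nat (r * h ^ 2)"
    proof -
      have "1 * (g' ^ 2 + d' ^ 2) < p ^ 2 * (g' ^ 2 + d' ^ 2)"
        using pos p1 by (intro mult_strict_right_mono) auto
      then show ?thesis using \<open>r * h ^ 2 > 0\<close> by (simp add: eq)
    qed
    show ?thesis
    proof (cases "p dvd h")
      case True
      then obtain h' where h': "h = p * h'" by blast
      then have "r * h' ^ 2 = g' ^ 2 + d' ^ 2"
        using eq p1 by (simp add: power_mult_distrib)
      then show ?thesis using less.hyps[of r h' g' d'] small less.prems h' by auto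
    next
      case False
      then have "coprime (p ^ 2) (h ^ 2)" using p(1) by (simp add: prime_imp_coprime)
      then have "p ^ 2 dvd r" using eq by (metis coprime_dvd_mult_left_iff dvd_triv_left)
      then obtain r' where r': "r = p ^ 2 * r'" by blast
      have e: "r' * h ^ 2 = g' ^ 2 + d' ^ 2" using eq r' p1 by simp
      moreover have "r' > 0" using less.prems(1) r' p1 by (simp add: zero_less_mult_iff)
      ultimately obtain x y where "r' = x ^ 2 + y ^ 2"
        using less.hyps[of r' h g' d'] small less.prems by auto
      then have "r = (p * x) ^ 2 + (p * y) ^ 2"
        using r' by (simp add: algebra_simps power_mult_distrib)
      then show ?thesis by blast
    qed
  qed
qed

section \<open>Traces and eigenvalue power sums\<close>

definition mat_trace :: "'a :: comm_semiring_0 mat \<Rightarrow> 'a" where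
  "mat_trace A = (\<Sum>i<dim_row A. A $$ (i, i))"

lemma mat_trace_mult:
  assumes "A \<in> carrier_mat n m" "B \<in> carrier_mat m n"
  shows "mat_trace (A * B) = (\<Sum>i<n. \<Sum>j<m. A $$ (i, j) * B $$ (j, i))"
  using assms by (auto simp: mat_trace_def scalar_prod_def atLeast0LessThan intro!: sum.cong)

lemma mat_trace_mult_commute:
  assumes "A \<in> carrier_mat n m" "B \<in> carrier_mat m n"
  shows "mat_trace (A * B) = mat_trace (B * A)"
  unfolding mat_trace_mult[OF assms] mat_trace_mult[OF assms(2,1)]
  by (subst sum.swap) (simp add: mult.commute)

lemma mat_trace_similar:
  assumes "similar_mat A B"
  shows "mat_trace A = mat_trace B"
proof -
  obtain n P Q where c: "{A, B, P, Q} \<subseteq> carrier_mat n n"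
    and QP: "Q * P = 1\<^sub>m n" and A: "A = P * B * Q"
    using similar_matD[OF assms] by blast
  have "mat_trace A = mat_trace (Q * (P * B))"
    unfolding A using c by (intro mat_trace_mult_commute) auto
  also have "Q * (P * B) = (Q * P) * B" using c by (subst assoc_mult_mat) auto
  also have "\<dots> = B" using c unfolding QP by (intro left_mult_one_mat) auto
  finally show ?thesis .
qed

text \<open>Only entries on and below the diagonal are described, which is enough both for traces
  and to close the induction: in the product, terms with l < i vanish by the induction hypothesis
  and those with l > i \<ge> j by triangularity.\<close>

lemma upper_triangular_pow:
  fixes A :: "'a :: comm_ring_1 mat"
  assumes A: "A \<in> carrier_mat n n" "upper_triangular A"
  shows "i < n \<Longrightarrow> j \<le> i \<Longrightarrow> (A ^\<^sub>m k) $$ (i, j) = (if i = j then (A $$ (i, i)) ^ k else 0)"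
proof (induction k arbitrary: i j)
  case 0
  then show ?case using A by simp
next
  case (Suc k)
  have [simp]: "A ^\<^sub>m k \<in> carrier_mat n n" using A by simp
  have "(A ^\<^sub>m Suc k) $$ (i, j) = (\<Sum>l<n. (A ^\<^sub>m k) $$ (i, l) * A $$ (l, j))"
    using Suc.prems A by (simp add: scalar_prod_def atLeast0LessThan)
  also have "\<dots> = (\<Sum>l<n. if l = i then (A ^\<^sub>m k) $$ (i, i) * A $$ (i, j) else 0)"
  proof (intro sum.cong refl)
    fix l assume "l \<in> {..<n}"
    then show "(A ^\<^sub>m k) $$ (i, l) * A $$ (l, j)
        = (if l = i then (A ^\<^sub>m k) $$ (i, i) * A $$ (i, j) else 0)"
      using Suc.IH[of i l] Suc.prems upper_triangularD[OF A(2), of j l] A(1)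
      by (cases l i rule: linorder_cases) auto
  qed
  also have "\<dots> = (A ^\<^sub>m k) $$ (i, i) * A $$ (i, j)" using Suc.prems by simp
  also have "\<dots> = (if i = j then (A $$ (i, i)) ^ Suc k else 0)"
    using Suc.IH[of i i] Suc.prems upper_triangularD[OF A(2), of j i] A(1) by auto
  finally show ?case .
qed

lemma order_prod_linear_factors:
  fixes as :: "'a :: idom list"
  shows "Polynomial.order x (\<Prod>a\<leftarrow>as. [:- a, 1:]) = count_list as x"
proof (induction as)
  case Nil
  then show ?case by (simp add: order_0I)
next
  case (Cons a as)
  have "(\<Prod>a\<leftarrow>as. [:- a, 1:]) \<noteq> 0" by (auto simp: prod_list_zero_iff)
  then have "[:- a, 1:] * (\<Prod>a\<leftarrow>as. [:- a, 1:]) \<noteq> 0"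
    unfolding mult_eq_0_iff by simp
  then show ?case using Cons by (simp add: order_mult order_linear' del: mult_pCons_left)
qed

lemma sum_list_map_eq_sum_count_list:
  fixes f :: "'a \<Rightarrow> 'b :: semiring_1"
  shows "(\<Sum>x\<leftarrow>xs. f x) = (\<Sum>x\<in>set xs. of_nat (count_list xs x) * f x)"
proof (induction xs)
  case (Cons a xs)
  have "(\<Sum>x\<in>set (a # xs). of_nat (count_list (a # xs) x) * f x)
      = (\<Sum>x\<in>insert a (set xs). (if x = a then f a else 0) + of_nat (count_list xs x) * f x)"
    by (intro sum.cong) (auto simp: algebra_simps)
  also have "\<dots> = f a + (\<Sum>x\<in>insert a (set xs). of_nat (count_list xs x) * f x)"
    by (simp add: sum.distrib)
  also have "(\<Sum>x\<in>insert a (set xs). of_nat (count_list xs x) * f x)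
      = (\<Sum>x\<in>set xs. of_nat (count_list xs x) * f x)"
    by (intro sum.mono_neutral_right) (auto simp: count_list_0_iff)
  finally show ?case using Cons by simp
qed simp

text \<open>Over the complex numbers the characteristic polynomial splits, so A is similar to an
  upper triangular T by Schur. The diagonal of T lists the eigenvalues with multiplicity, and that
  of T^k lists their k-th powers. This makes every spectral condition a count of closed
  walks.\<close>

lemma eigenvalue_power_sum_eq_trace:
  assumes A: "A \<in> carrier_mat n n"
  shows "eigenvalue_power_sum A k = mat_trace (A ^\<^sub>m k)"
proof -
  obtain es where es: "char_poly A = (\<Prod>a\<leftarrow>es. [:- a, 1:])"
    using char_poly_factorized[OF A] by blast
  then obtain T where T: "T \<in> carrier_mat n n" "upper_triangular T" and sim: "similar_mat A T"
    using schur_decomposition_exists[OF A] by blast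
  let ?ds = "diag_mat T"
  have cp: "char_poly A = (\<Prod>a\<leftarrow>?ds. [:- a, 1:])"
    using char_poly_similar[OF sim] char_poly_upper_triangular[OF T] by simp
  have spec: "spectrum A = set ?ds"
    unfolding spectrum_root_char_poly[OF A] cp by (auto simp: poly_prod_list prod_list_zero_iff)
  obtain P Q where "similar_mat_wit A T P Q" using sim unfolding similar_mat_def by blast
  then have "similar_mat_wit (A ^\<^sub>m k) (T ^\<^sub>m k) P Q" by (rule similar_mat_wit_pow)
  then have "similar_mat (A ^\<^sub>m k) (T ^\<^sub>m k)" unfolding similar_mat_def by blast
  then have "mat_trace (A ^\<^sub>m k) = mat_trace (T ^\<^sub>m k)" by (rule mat_trace_similar)
  also have "\<dots> = (\<Sum>i<n. (T $$ (i, i)) ^ k)"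
    using upper_triangular_pow[OF T] T(1) by (simp add: mat_trace_def)
  also have "\<dots> = (\<Sum>x\<leftarrow>?ds. x ^ k)"
    using T(1) by (simp add: diag_mat_def comp_def interv_sum_list_conv_sum_set_nat atLeast0LessThan)
  also have "\<dots> = (\<Sum>x\<in>set ?ds. of_nat (count_list ?ds x) * x ^ k)"
    by (rule sum_list_map_eq_sum_count_list)
  also have "\<dots> = eigenvalue_power_sum A k"
    unfolding eigenvalue_power_sum_def spec cp order_prod_linear_factors ..
  finally show ?thesis ..
qed

section \<open>Principal minors and the characteristic polynomial\<close>

text \<open>Conjugation by the enumeration b is a sign-preserving bijection between permutations of
  {0..<m} and of I. Hence a Leibniz sum over a bare index set is a genuine determinant, whichever
  enumeration is chosen.\<close>

lemma det_principal_submatrix: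
  fixes f :: "nat \<Rightarrow> nat \<Rightarrow> 'a :: comm_ring_1"
  assumes b: "bij_betw b {0..<m} I"
  shows "det (mat m m (\<lambda>(i, j). f (b i) (b j)))
    = (\<Sum>p | p permutes I. signof p * (\<Prod>i\<in>I. f i (p i)))"
proof -
  let ?M = "map_permutation {0..<m} b"
  have inj: "inj_on b {0..<m}" and I: "b ` {0..<m} = I" using b by (auto simp: bij_betw_def)
  have "(\<Sum>p | p permutes I. signof p * (\<Prod>i\<in>I. f i (p i)))
      = (\<Sum>p | p permutes {0..<m}. signof (?M p) * (\<Prod>i\<in>I. f i (?M p i)))"
  proof (rule sum.reindex_bij_witness[where i = ?M and j = "map_permutation I (inv_into {0..<m} b)"])
    fix p assume "p \<in> {p. p permutes I}"
    then have p: "p permutes I" by simp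
    have b': "bij_betw (inv_into {0..<m} b) I {0..<m}" using b by (rule bij_betw_inv_into)
    show "?M (map_permutation I (inv_into {0..<m} b) p) = p"
      using map_permutation_compose_inv[OF b' p] b
      by (metis I f_inv_into_f)
    then show "signof (?M (map_permutation I (inv_into {0..<m} b) p)) *
        (\<Prod>i\<in>I. f i (?M (map_permutation I (inv_into {0..<m} b) p) i)) = signof p * (\<Prod>i\<in>I. f i (p i))"
      by simp
    show "map_permutation I (inv_into {0..<m} b) p \<in> {p. p permutes {0..<m}}"
      using map_permutation_permutes[OF b' p] by simp
  next
    fix p assume "p \<in> {p. p permutes {0..<m}}"
    then have p: "p permutes {0..<m}" by simp
    show "?M p \<in> {p. p permutes I}" using map_permutation_permutes[OF b p] by simp
    show "map_permutation I (inv_into {0..<m} b) (?M p) = p"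
      by (rule map_permutation_compose_inv[OF b p]) (use inj in simp)
  qed
  also have "\<dots> = (\<Sum>p | p permutes {0..<m}. signof p * (\<Prod>i\<in>{0..<m}. f (b i) (b (p i))))"
  proof (intro sum.cong refl arg_cong2[where f = "(*)"])
    fix p assume "p \<in> {p. p permutes {0..<m}}"
    then have p: "p permutes {0..<m}" by simp
    show "signof (?M p) = signof p"
      using sign_map_permutation[OF inj p] by simp
    show "(\<Prod>i\<in>I. f i (?M p i)) = (\<Prod>i\<in>{0..<m}. f (b i) (b (p i)))"
      unfolding I[symmetric] by (simp add: prod.reindex[OF inj] map_permutation_apply[OF inj])
  qed
  also have "\<dots> = det (mat m m (\<lambda>(i, j). f (b i) (b j)))"
    unfolding det_def by (auto intro!: sum.cong prod.cong arg_cong2[where f = "(*)"]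
        simp: permutes_in_image[where S="{0..<m}", simplified])
  finally show ?thesis ..
qed

text \<open>The coefficient of x^k in det(xI - A) is the sum of all principal minors of -A of size n
  - k; a nonzero sum has a nonzero term. The minor is left as a Leibniz sum over I, so no
  enumeration of I is needed yet.\<close>

lemma coeff_char_poly_nonzero_imp_minor:
  fixes A :: "'a :: comm_ring_1 mat"
  assumes A: "A \<in> carrier_mat n n" and nz: "coeff (char_poly A) k \<noteq> 0"
  obtains I where "I \<subseteq> {0..<n}" "card I = n - k"
    "(\<Sum>p | p permutes I. signof p * (\<Prod>i\<in>I. - A $$ (i, p i))) \<noteq> 0"
proof -
  let ?U = "{0..<n}"
  let ?x = "\<lambda>p i. if i = p i then [:0, 1:] else (0 :: 'a poly)"
  let ?a = "\<lambda>p i. [:- A $$ (i, p i):]"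
  have "char_poly A = (\<Sum>p | p permutes ?U. signof p * (\<Prod>i\<in>?U. ?x p i + ?a p i))"
    unfolding char_poly_defs using A
    by (subst det_def'[of _ n]) (auto intro!: sum.cong prod.cong arg_cong2[where f = "(*)"])
  \<comment> \<open>J collects the rows from which the x-part of the diagonal entry is
    taken.\<close>
  also have "\<dots> = (\<Sum>p | p permutes ?U. \<Sum>J\<in>Pow ?U. signof p * (prod (?x p) J * prod (?a p) (?U - J)))"
    by (simp add: prod_add sum_distrib_left)
  also have "\<dots> = (\<Sum>J\<in>Pow ?U. \<Sum>p | p permutes ?U. signof p * (prod (?x p) J * prod (?a p) (?U - J)))"
    by (rule sum.swap)
  also have "\<dots> = (\<Sum>J\<in>Pow ?U. monom (\<Sum>p | p permutes (?U - J).
      signof p * (\<Prod>i\<in>?U - J. - A $$ (i, p i))) (card J))"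
  proof (intro sum.cong refl)
    fix J assume J: "J \<in> Pow ?U"
    then have fin: "finite J" using finite_subset by auto
    \<comment> \<open>A permutation moving some point of J picks an off-diagonal entry there, whose
      x-part is zero; the survivors are the permutations of the complement of J.\<close>
    have "(\<Sum>p | p permutes ?U. signof p * (prod (?x p) J * prod (?a p) (?U - J)))
        = (\<Sum>p | p permutes (?U - J). signof p * (prod (?x p) J * prod (?a p) (?U - J)))"
    proof (rule sum.mono_neutral_right)
      show "\<forall>p\<in>{p. p permutes ?U} - {p. p permutes (?U - J)}.
          signof p * (prod (?x p) J * prod (?a p) (?U - J)) = 0"
      proof
        fix p assume p: "p \<in> {p. p permutes ?U} - {p. p permutes (?U - J)}"
        have "\<exists>j\<in>J. p j \<noteq> j"
        proof (rule ccontr)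
          assume "\<not> ?thesis"
          then have "p permutes (?U - J)"
            using p using permutes_superset[of p ?U "?U - J"] by auto
          then show False using p by simp
        qed
        then have "prod (?x p) J = 0" using fin by (force intro!: prod_zero)
        then show "signof p * (prod (?x p) J * prod (?a p) (?U - J)) = 0" by simp
      qed
    next
      show "finite {p. p permutes ?U}" by (simp add: finite_permutations)
    next
      show "{p. p permutes (?U - J)} \<subseteq> {p. p permutes ?U}"
        using permutes_subset[OF _ Diff_subset] by blast
    qed
    also have "\<dots> = (\<Sum>p | p permutes (?U - J).
        monom (signof p * (\<Prod>i\<in>?U - J. - A $$ (i, p i))) (card J))"
    proof (intro sum.cong refl)
      fix p assume "p \<in> {p. p permutes (?U - J)}"
      then have p: "p i = i" if "i \<in> J" for i using that by (auto simp: permutes_def)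
      have "prod (?x p) J = [:0, 1:] ^ card J" by (simp add: p)
      moreover have "prod (?a p) (?U - J) = [:\<Prod>i\<in>?U - J. - A $$ (i, p i):]"
        by (simp add: prod_to_poly)
      moreover have "[:0, 1:] ^ k * [:c:] = monom c k" for c :: 'a and k
        by (simp add: monom_altdef)
      ultimately have "prod (?x p) J * prod (?a p) (?U - J)
          = monom (\<Prod>i\<in>?U - J. - A $$ (i, p i)) (card J)"
        by simp
      then show "signof p * (prod (?x p) J * prod (?a p) (?U - J))
          = monom (signof p * (\<Prod>i\<in>?U - J. - A $$ (i, p i))) (card J)"
        by (cases p rule: sign_cases) (simp_all only: minus_monom mult_1 mult_minus1 of_int_1 of_int_minus)
    qed
    also have "\<dots> = monom (\<Sum>p | p permutes (?U - J).
        signof p * (\<Prod>i\<in>?U - J. - A $$ (i, p i))) (card J)"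
      by (rule monom_sum[symmetric])
    finally show "(\<Sum>p | p permutes ?U. signof p * (prod (?x p) J * prod (?a p) (?U - J))) = \<dots>" .
  qed
  finally have c: "coeff (char_poly A) k = (\<Sum>J\<in>Pow ?U. if card J = k then
      (\<Sum>p | p permutes (?U - J). signof p * (\<Prod>i\<in>?U - J. - A $$ (i, p i))) else 0)"
    by (simp add: coeff_sum)
  obtain J where "J \<in> Pow ?U" "(if card J = k then
      (\<Sum>p | p permutes (?U - J). signof p * (\<Prod>i\<in>?U - J. - A $$ (i, p i))) else 0) \<noteq> 0"
    using sum.not_neutral_contains_not_neutral[OF nz[unfolded c]] .
  then have J: "J \<subseteq> ?U" "card J = k"
    "(\<Sum>p | p permutes (?U - J). signof p * (\<Prod>i\<in>?U - J. - A $$ (i, p i))) \<noteq> 0"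
    by (auto split: if_splits)
  moreover have "card (?U - J) = n - k" using J by (simp add: card_Diff_subset finite_subset)
  ultimately show ?thesis using that[of "?U - J"] by blast
qed

section \<open>Symmetric integer square roots of scalar matrices\<close>

text \<open>Values of integer polynomials at \<mu> lie in Z[\<mu>], and replacing \<mu> by -\<mu>
  acts as conjugation. The point is that the same g and h serve both evaluations, even if r is a
  perfect square.\<close>

lemma poly_at_square_root:
  fixes \<mu> :: "'a :: comm_ring_1" and p :: "int poly"
  assumes "\<mu> ^ 2 = of_int r"
  shows "\<exists>g h. poly (map_poly of_int p) \<mu> = of_int g + \<mu> * of_int h \<and>
    poly (map_poly of_int p) (- \<mu>) = of_int g - \<mu> * of_int h"
proof (induction p)
  case 0
  show ?case by (intro exI[of _ 0]) simp
next
  case (pCons c p)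
  then obtain g h where gh: "poly (map_poly of_int p) \<mu> = of_int g + \<mu> * of_int h"
    "poly (map_poly of_int p) (- \<mu>) = of_int g - \<mu> * of_int h" by blast
  have \<mu>: "\<mu> * (\<mu> * x) = of_int r * x" for x
    using assms by (simp add: power2_eq_square flip: mult.assoc)
  \<comment> \<open>Horner step: c + \<mu>(g + \<mu>h) = (c + rh) + \<mu>g.\<close>
  have "poly (map_poly of_int (pCons c p)) \<mu> = of_int (c + r * h) + \<mu> * of_int g"
    "poly (map_poly of_int (pCons c p)) (- \<mu>) = of_int (c + r * h) - \<mu> * of_int g"
    by (simp_all add: of_int_hom.map_poly_pCons_hom gh distrib_left right_diff_distrib \<mu>)
  then show ?case by blast
qed

text \<open>Substituting x + e for x is a ring homomorphism, so it commutes with the determinant,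
  and it turns xI - A into xI - (A - eI).\<close>

lemma char_poly_shift:
  fixes A :: "'a :: field mat"
  assumes A: "A \<in> carrier_mat n n"
  shows "char_poly (char_matrix A e) = pcompose (char_poly A) [:e, 1:]"
proof -
  have h: "comm_ring_hom (\<lambda>p :: 'a poly. pcompose p [:e, 1:])"
    by unfold_locales
  have "char_poly_matrix (char_matrix A e) = map_mat (\<lambda>p. pcompose p [:e, 1:]) (char_poly_matrix A)"
    using A by (intro eq_matI) (auto simp: char_poly_matrix_def char_matrix_def pcompose_pCons)
  then show ?thesis unfolding char_poly_def by (simp add: comm_ring_hom.hom_det[OF h])
qed

text \<open>The shift moves the root e to 0 with its multiplicity m. After splitting off x^m, the
  cofactor at 0 is q(e), which is nonzero. This converts a multiplicity into a nonvanishing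
  coefficient, and so into a nonzero minor.\<close>

lemma coeff_char_poly_shift_nonzero:
  fixes A :: "'a :: field mat"
  assumes A: "A \<in> carrier_mat n n"
  shows "coeff (char_poly (char_matrix A e)) (Polynomial.order e (char_poly A)) \<noteq> 0"
proof -
  let ?m = "Polynomial.order e (char_poly A)"
  have "char_poly A \<noteq> 0" using degree_monic_char_poly[OF A] by auto
  then obtain q where q: "char_poly A = [:- e, 1:] ^ ?m * q" "\<not> [:- e, 1:] dvd q"
    using order_decomp by blast
  have "char_poly (char_matrix A e) = [:0, 1:] ^ ?m * pcompose q [:e, 1:]"
    unfolding char_poly_shift[OF A] by (subst q(1)) (simp add: pcompose_mult pcompose_hom.hom_power pcompose_pCons)
  also have "\<dots> = monom 1 ?m * pcompose q [:e, 1:]" by (simp add: monom_altdef)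
  finally have "coeff (char_poly (char_matrix A e)) ?m = coeff (pcompose q [:e, 1:]) 0"
    by (simp add: coeff_monom_mult)
  also have "\<dots> = poly q e" by (simp add: poly_pcompose flip: poly_0_coeff_0)
  also have "\<dots> \<noteq> 0" using q(2) by (simp add: poly_eq_0_iff_dvd)
  finally show ?thesis .
qed

lemma sum_of_two_squares_if_symmetric_square_root:
  fixes S :: "int mat" and \<mu> :: complex
  assumes S: "S \<in> carrier_mat (2 * m) (2 * m)" and r: "r > 0" and m: "odd m"
    and sym: "\<And>i j. i < 2 * m \<Longrightarrow> j < 2 * m \<Longrightarrow> S $$ (i, j) = S $$ (j, i)"
    and sq: "\<And>i j. i < 2 * m \<Longrightarrow> j < 2 * m \<Longrightarrow>
      (\<Sum>k<2 * m. S $$ (i, k) * S $$ (k, j)) = (if i = j then r else 0)"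
    and \<mu>: "\<mu> ^ 2 = of_int r"
    and ord: "Polynomial.order \<mu> (char_poly (map_mat of_int S)) = m"
  shows "\<exists>x y. r = x ^ 2 + y ^ 2"
proof -
  let ?U = "{0..<2 * m}"
  let ?C = "map_mat complex_of_int S"
  have C: "?C \<in> carrier_mat (2 * m) (2 * m)" using S by simp
  have "char_matrix ?C \<mu> \<in> carrier_mat (2 * m) (2 * m)" using C by simp
  moreover have "coeff (char_poly (char_matrix ?C \<mu>)) m \<noteq> 0"
    using coeff_char_poly_shift_nonzero[OF C, of \<mu>] ord by simp
  \<comment> \<open>The multiplicity m is exactly half the dimension, so I and its complement have
    equal size; this makes the off-diagonal block \<open>B\<close> square.\<close>
  ultimately obtain I where I: "I \<subseteq> ?U" "card I = 2 * m - m"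
    and nz: "(\<Sum>p | p permutes I. signof p * (\<Prod>i\<in>I. - char_matrix ?C \<mu> $$ (i, p i))) \<noteq> 0"
    by (rule coeff_char_poly_nonzero_imp_minor)
  have fin: "finite I" "finite (?U - I)" using I(1) finite_subset by auto
  have card: "card I = m" "card (?U - I) = m"
    using I fin by (simp_all add: card_Diff_subset)
  obtain b where b: "bij_betw b {0..<m} I"
    using ex_bij_betw_nat_finite[OF fin(1)] card by auto
  obtain c where c: "bij_betw c {0..<m} (?U - I)"
    using ex_bij_betw_nat_finite[OF fin(2)] card by auto
  have bU: "b i < 2 * m" "c i < 2 * m" if "i < m" for i
    using that b c I(1) by (force simp: bij_betw_def)+
  have binj: "b i = b j \<longleftrightarrow> i = j" if "i < m" "j < m" for i j
    using that b by (auto simp: bij_betw_def inj_on_def)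
  define A where "A = mat m m (\<lambda>(i, j). S $$ (b i, b j))"
  define B where "B = mat m m (\<lambda>(i, j). S $$ (b i, c j))"
  \<comment> \<open>This is the block of S^2 = rI indexed by I: A^2 + BB^T = rI. Symmetry of S
    identifies the block below the diagonal with B^T.\<close>
  have AB: "(\<Sum>k<m. A $$ (i, k) * A $$ (k, j)) + (\<Sum>k<m. B $$ (i, k) * B $$ (j, k))
      = (if i = j then r else 0)" if ij: "i < m" "j < m" for i j
  proof -
    let ?f = "\<lambda>k. S $$ (b i, k) * S $$ (k, b j)"
    have "(\<Sum>k<m. A $$ (i, k) * A $$ (k, j)) = (\<Sum>k\<in>{0..<m}. ?f (b k))"
      using ij by (auto simp: A_def intro!: sum.cong)
    also have "\<dots> = sum ?f I" by (rule sum.reindex_bij_betw[OF b])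
    finally have 1: "(\<Sum>k<m. A $$ (i, k) * A $$ (k, j)) = sum ?f I" .
    have "(\<Sum>k<m. B $$ (i, k) * B $$ (j, k)) = (\<Sum>k\<in>{0..<m}. ?f (c k))"
      using ij bU sym by (auto simp: B_def intro!: sum.cong)
    also have "\<dots> = sum ?f (?U - I)" by (rule sum.reindex_bij_betw[OF c])
    finally have "(\<Sum>k<m. B $$ (i, k) * B $$ (j, k)) = sum ?f (?U - I)" .
    with 1 have "(\<Sum>k<m. A $$ (i, k) * A $$ (k, j)) + (\<Sum>k<m. B $$ (i, k) * B $$ (j, k))
        = sum ?f ?U"
      using sum.subset_diff[OF I(1), of ?f] by simp
    also have "\<dots> = (if i = j then r else 0)"
      using sq[OF bU(1)[OF ij(1)] bU(1)[OF ij(2)]] binj ij by (simp add: atLeast0LessThan)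
    finally show ?thesis .
  qed
  let ?A = "map_mat complex_of_int A" and ?B = "map_mat complex_of_int B"
  have cA: "?A \<in> carrier_mat m m" and cB: "?B \<in> carrier_mat m m" and A: "A \<in> carrier_mat m m"
    by (auto simp: A_def B_def)
  define f where "f = char_poly A"
  \<comment> \<open>\<open>X e\<close> is eI - A, whose determinant is the value at e of the integer
    polynomial \<open>f\<close>.\<close>
  define X where "X = (\<lambda>e. - char_matrix ?A e)"
  have cX: "X e \<in> carrier_mat m m" for e using cA by (simp add: X_def)
  have X: "X e $$ (i, j) = (if i = j then e else 0) - of_int (A $$ (i, j))" if "i < m" "j < m" for e i j
    using that by (simp add: X_def char_matrix_def A_def)
  have "char_poly ?A = map_poly of_int f" unfolding f_def by (rule of_int_hom.char_poly_hom[OF A])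
  then have fX: "poly (map_poly of_int f) e = det (X e)" for e
    using char_poly_matrix[OF cA] by (simp add: X_def)
  \<comment> \<open>The minor chosen above belongs to -(S - \<mu>I), so restricted to I it is
    precisely \<mu>I - A.\<close>
  have "det (X \<mu>) = det (mat m m (\<lambda>(i, j). - char_matrix ?C \<mu> $$ (b i, b j)))"
  proof (rule arg_cong[where f = det], rule eq_matI)
    fix i j assume "i < dim_row (mat m m (\<lambda>(i, j). - char_matrix ?C \<mu> $$ (b i, b j)))"
      "j < dim_col (mat m m (\<lambda>(i, j). - char_matrix ?C \<mu> $$ (b i, b j)))"
    then have ij: "i < m" "j < m" by auto
    then show "X \<mu> $$ (i, j) = mat m m (\<lambda>(i, j). - char_matrix ?C \<mu> $$ (b i, b j)) $$ (i, j)"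
      using S bU binj by (simp add: X) (simp add: char_matrix_def A_def)
  qed (use cX in auto)
  also have "\<dots> \<noteq> 0" using nz det_principal_submatrix[OF b, of "\<lambda>i j. - char_matrix ?C \<mu> $$ (i, j)"] by simp
  finally have f0: "poly (map_poly of_int f) \<mu> \<noteq> 0" unfolding fX .
  have "X \<mu> * X (- \<mu>) = - (?B * transpose_mat ?B)"
  proof (rule eq_matI)
    fix i j assume "i < dim_row (- (?B * transpose_mat ?B))" "j < dim_col (- (?B * transpose_mat ?B))"
    then have ij: "i < m" "j < m" using cB by auto
    have "(X \<mu> * X (- \<mu>)) $$ (i, j) = (\<Sum>k<m. X \<mu> $$ (i, k) * X (- \<mu>) $$ (k, j))"
      using cX[of \<mu>] cX[of "- \<mu>"] ij by (simp add: scalar_prod_def atLeast0LessThan)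
    \<comment> \<open>The terms linear in \<mu> occur only at k = i and k = j, with opposite signs,
      and cancel. What remains is A^2 - rI = -BB^T.\<close>
    also have "\<dots> = (\<Sum>k<m. (if k = i then (if i = j then - (\<mu> ^ 2) else 0) - \<mu> * of_int (A $$ (i, j)) else 0)
        + (if k = j then \<mu> * of_int (A $$ (i, j)) else 0) + of_int (A $$ (i, k) * A $$ (k, j)))"
      using ij by (intro sum.cong) (auto simp: X algebra_simps power2_eq_square)
    also have "\<dots> = (if i = j then - (\<mu> ^ 2) else 0) + of_int (\<Sum>k<m. A $$ (i, k) * A $$ (k, j))"
      using ij by (simp add: sum.distrib)
    also have "\<dots> = of_int (- (\<Sum>k<m. B $$ (i, k) * B $$ (j, k)))"
    proof -
      have "(\<Sum>k<m. A $$ (i, k) * A $$ (k, j))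
          = (if i = j then r else 0) - (\<Sum>k<m. B $$ (i, k) * B $$ (j, k))"
        using AB[OF ij] by linarith
      then show ?thesis unfolding \<mu> by (simp del: of_int_sum of_int_mult)
    qed
    also have "\<dots> = (- (?B * transpose_mat ?B)) $$ (i, j)"
      using ij by (simp add: B_def scalar_prod_def atLeast0LessThan)
    finally show "(X \<mu> * X (- \<mu>)) $$ (i, j) = (- (?B * transpose_mat ?B)) $$ (i, j)" .
  qed (use cX[of \<mu>] cX[of "- \<mu>"] cB in auto)
  then have "det (X \<mu>) * det (X (- \<mu>)) = det (- (?B * transpose_mat ?B))"
    using det_mult[OF cX[of \<mu>] cX[of "- \<mu>"]] by simp
  \<comment> \<open>Oddness of m enters here: the scalar contributes (-1)^m = -1, so the determinant
    is minus a square.\<close>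
  also have "- (?B * transpose_mat ?B) = (- 1) \<cdot>\<^sub>m (?B * transpose_mat ?B)" by (intro eq_matI) auto
  also have "det \<dots> = - (det ?B * det ?B)"
    using det_mult[OF cB transpose_carrier_mat[THEN iffD2, OF cB]] cB m det_transpose[OF cB]
    by (simp add: det_smult)
  also have "det ?B = of_int (det B)" by simp
  finally have prod: "poly (map_poly of_int f) \<mu> * poly (map_poly of_int f) (- \<mu>)
      = of_int (- (det B * det B))"
    unfolding fX by simp
  obtain g h where gh: "poly (map_poly of_int f) \<mu> = of_int g + \<mu> * of_int h"
    "poly (map_poly of_int f) (- \<mu>) = of_int g - \<mu> * of_int h"
    using poly_at_square_root[OF \<mu>] by blast
  have "complex_of_int (r * h ^ 2) = of_int (g ^ 2 + det B ^ 2)"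
  proof -
    have "(of_int g + \<mu> * of_int h) * (of_int g - \<mu> * of_int h)
        = complex_of_int g ^ 2 - \<mu> ^ 2 * of_int h ^ 2"
      by (simp add: algebra_simps power2_eq_square)
    then show ?thesis using prod unfolding gh \<mu> by (simp add: algebra_simps power2_eq_square)
  qed
  then have eq: "r * h ^ 2 = g ^ 2 + det B ^ 2" by (simp only: of_int_eq_iff)
  \<comment> \<open>With h = 0 the sum of squares g^2 + det(B)^2 would vanish, so f(\<mu>) = g = 0,
    against the choice of I.\<close>
  have "h \<noteq> 0"
  proof
    assume "h = 0"
    then have "g = 0" using eq by simp
    then show False using f0 \<open>h = 0\<close> gh by simp
  qed
  then show ?thesis using sum_of_two_squares_if_mult_square[OF r _ eq] by blast
qed

section \<open>Counting walks in rectagraphs\<close>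

context pair_graph
begin

definition neighbours :: "'a \<Rightarrow> 'a set" where
  "neighbours u = {w. (u, w) \<in> parcs G}"

lemma arc_commute: "(u, v) \<in> parcs G \<longleftrightarrow> (v, u) \<in> parcs G"
  using pair_sym_arcs by (auto simp: symmetric_def dest: symD)

lemma neighbours_commute: "u \<in> neighbours v \<longleftrightarrow> v \<in> neighbours u"
  unfolding neighbours_def using arc_commute by simp

lemma neighbours_subset: "neighbours u \<subseteq> pverts G"
  using in_arcsD2 by (auto simp: neighbours_def)

lemma finite_neighbours [simp]: "finite (neighbours u)"
  using finite_subset[OF neighbours_subset pair_finite_verts] .

lemma not_in_own_neighbours [simp]: "u \<notin> neighbours u"
  using pair_no_loops by (force simp: neighbours_def)

lemma common_neighbours_eq: "common_neighbours G u v = neighbours u \<inter> neighbours v"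
  by (auto simp: common_neighbours_def neighbours_def)

lemma card_neighbours:
  assumes "regular_of_degree G r" "u \<in> pverts G"
  shows "card (neighbours u) = r"
proof -
  have "out_arcs (with_proj G) u = Pair u ` neighbours u"
    by (auto simp: out_arcs_def neighbours_def)
  then have "out_degree (with_proj G) u = card (neighbours u)"
    by (simp add: out_degree_def card_image inj_on_def)
  then show ?thesis using assms by (simp add: regular_of_degree_def)
qed

text \<open>Double count of walks of length two from u: r choices for the middle vertex and r for
  the end. Walks returning to u are included.\<close>

lemma sum_card_common_neighbours:
  assumes reg: "regular_of_degree G r" and u: "u \<in> pverts G"
  shows "(\<Sum>v\<in>pverts G. card (common_neighbours G u v)) = r * r"
proof -
  have "(\<Sum>v\<in>pverts G. card (common_neighbours G u v))
      = (\<Sum>v\<in>pverts G. card {w \<in> neighbours u. w \<in> neighbours v})"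
    by (simp add: common_neighbours_eq Int_def)
  also have "\<dots> = r * card (neighbours u)"
  proof (rule sum_multicount[OF pair_finite_verts finite_neighbours], rule ballI)
    fix w assume "w \<in> neighbours u"
    then have "w \<in> pverts G" using neighbours_subset by blast
    moreover have "{v \<in> pverts G. w \<in> neighbours v} = neighbours w"
      using neighbours_subset neighbours_commute by blast
    ultimately show "card {v \<in> pverts G. w \<in> neighbours v} = r"
      using card_neighbours[OF reg] by simp
  qed
  finally show ?thesis using card_neighbours[OF reg u] by simp
qed

text \<open>Hides the enumeration of the vertices: products and traces of such matrices become sums
  over vertices, so walk counts need no indices.\<close>

definition vertex_mat :: "('a \<Rightarrow> 'a \<Rightarrow> 'b) \<Rightarrow> 'b mat" where
  "vertex_mat f = mat (card (pverts G)) (card (pverts G))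
     (\<lambda>(i, j). f (vertex_list G ! i) (vertex_list G ! j))"

lemma vertex_mat_carrier [simp]: "vertex_mat f \<in> carrier_mat (card (pverts G)) (card (pverts G))"
  by (simp add: vertex_mat_def)

lemma map_vertex_mat: "map_mat h (vertex_mat f) = vertex_mat (\<lambda>u v. h (f u v))"
  by (auto simp: vertex_mat_def)

lemma nth_vertex_list_bij: "bij_betw ((!) (vertex_list G)) {..<card (pverts G)} (pverts G)"
  using vertex_list[OF pair_finite_verts] bij_betw_nth by metis

lemma sum_vertex_list:
  "(\<Sum>i<card (pverts G). f (vertex_list G ! i)) = (\<Sum>v\<in>pverts G. f v)"
  by (rule sum.reindex_bij_betw[OF nth_vertex_list_bij])

lemma vertex_mat_mult:
  fixes f g :: "'a \<Rightarrow> 'a \<Rightarrow> 'b :: semiring_0"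
  shows "vertex_mat f * vertex_mat g = vertex_mat (\<lambda>u v. \<Sum>w\<in>pverts G. f u w * g w v)"
  by (intro eq_matI)
    (simp_all add: vertex_mat_def scalar_prod_def atLeast0LessThan flip: sum_vertex_list)

lemma trace_vertex_mat: "mat_trace (vertex_mat f) = (\<Sum>v\<in>pverts G. f v v)"
  by (simp add: mat_trace_def vertex_mat_def flip: sum_vertex_list)

lemma adjacency_matrix_eq:
  "adjacency_matrix G = vertex_mat (\<lambda>u v. if v \<in> neighbours u then 1 else 0)"
  using vertex_list(3)[OF pair_finite_verts]
  by (simp add: adjacency_matrix_def vertex_mat_def Let_def neighbours_def)

lemma adjacency_matrix_square:
  "adjacency_matrix G * adjacency_matrix G
    = vertex_mat (\<lambda>u v. of_nat (card (common_neighbours G u v)))"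
proof -
  have "(\<Sum>w\<in>pverts G. (if w \<in> neighbours u then 1 else 0) * (if v \<in> neighbours w then 1 else 0))
      = (of_nat (card (common_neighbours G u v)) :: complex)" for u v
  proof -
    have "(\<Sum>w\<in>pverts G. (if w \<in> neighbours u then 1 else 0) * (if v \<in> neighbours w then 1 else 0))
        = (\<Sum>w\<in>pverts G. if w \<in> common_neighbours G u v then 1 else 0 :: complex)"
      using neighbours_commute by (auto simp: common_neighbours_eq intro!: sum.cong)
    also have "\<dots> = of_nat (card (pverts G \<inter> common_neighbours G u v))"
      using pair_finite_verts by (simp flip: sum.inter_restrict)
    also have "pverts G \<inter> common_neighbours G u v = common_neighbours G u v"
      using neighbours_subset by (auto simp: common_neighbours_eq)
    finally show ?thesis .
  qed
  then show ?thesis unfolding adjacency_matrix_eq vertex_mat_mult by simp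
qed

end

section \<open>Counts that use the zero-or-two condition and the absence of triangles\<close>

context signed_rectagraph
begin

lemma common_neighbours_adjacent: "v \<in> neighbours u \<Longrightarrow> common_neighbours G u v = {}"
  using triangle_free arc_commute unfolding triangle_free_def common_neighbours_def neighbours_def
  by blast

lemma common_neighbours_self: "common_neighbours G u u = neighbours u"
  by (simp add: common_neighbours_eq)

lemma sum_card_common_neighbours_other:
  assumes reg: "regular_of_degree G r" and u: "u \<in> pverts G"
  shows "(\<Sum>v\<in>pverts G - {u}. card (common_neighbours G u v)) = r * (r - 1)"
proof -
  have "r + (\<Sum>v\<in>pverts G - {u}. card (common_neighbours G u v)) = r * r"
    using sum_card_common_neighbours[OF assms] sum.remove[OF pair_finite_verts u]
    by (metis card_neighbours[OF assms] common_neighbours_self)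
  then show ?thesis by (cases r) auto
qed

text \<open>Every vertex other than u that is reached from u by a walk of length two is reached by
  exactly two of them.\<close>

lemma card_two_common_neighbours:
  assumes reg: "regular_of_degree G r" and u: "u \<in> pverts G"
  shows "2 * card {v \<in> pverts G - {u}. card (common_neighbours G u v) = 2} = r * (r - 1)"
proof -
  have "(\<Sum>v\<in>pverts G - {u}. card (common_neighbours G u v))
      = (\<Sum>v\<in>pverts G - {u}. if card (common_neighbours G u v) = 2 then 2 else 0)"
    using zero_or_two[OF u] by (intro sum.cong) auto
  also have "\<dots> = 2 * card {v \<in> pverts G - {u}. card (common_neighbours G u v) = 2}"
    using pair_finite_verts by (simp flip: sum.inter_filter)
  finally show ?thesis using sum_card_common_neighbours_other[OF assms] by simp
qed

text \<open>The vertices split into u, its r neighbours, the (r choose 2) vertices sharing two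
  neighbours with u, and a remainder. Absence of triangles keeps the second and third classes
  disjoint. The remainder measures the slack in the lower bound for n.\<close>

lemma card_verts_eq:
  assumes reg: "regular_of_degree G r" and u: "u \<in> pverts G"
  shows "card (pverts G) = Suc ((r choose 2) + r)
    + card {v \<in> pverts G - {u} - neighbours u. common_neighbours G u v = {}}"
proof -
  let ?D = "{v \<in> pverts G - {u}. card (common_neighbours G u v) = 2}"
  let ?Z = "{v \<in> pverts G - {u} - neighbours u. common_neighbours G u v = {}}"
  have fin: "finite (common_neighbours G u v)" for v by (simp add: common_neighbours_eq)
  have "pverts G = {u} \<union> (neighbours u \<union> (?D \<union> ?Z))"
    using u neighbours_subset[of u] zero_or_two[OF u] fin by fastforce
  also have "card \<dots> = Suc (r + (card ?D + card ?Z))"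
  proof -
    have "card (?D \<union> ?Z) = card ?D + card ?Z"
      using pair_finite_verts by (intro card_Un_disjoint) auto
    moreover have "card (neighbours u \<union> (?D \<union> ?Z)) = card (neighbours u) + card (?D \<union> ?Z)"
      using pair_finite_verts common_neighbours_adjacent[of _ u]
      by (intro card_Un_disjoint) force+
    moreover have "card ({u} \<union> (neighbours u \<union> (?D \<union> ?Z)))
        = card {u} + card (neighbours u \<union> (?D \<union> ?Z))"
      using pair_finite_verts by (intro card_Un_disjoint) auto
    ultimately show ?thesis using card_neighbours[OF assms] by simp
  qed
  also have "card ?D = r choose 2" using card_two_common_neighbours[OF assms] by (simp add: choose_two)
  finally show ?thesis by simp
qed

text \<open>Equality empties the remainder at every vertex u, so each non-neighbour of u shares
  some, hence exactly two, neighbours with it.\<close>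

lemma strongly_regular_if_card_verts:
  assumes reg: "regular_of_degree G r" and n: "card (pverts G) = ((r + 1) choose 2) + 1"
  shows "strongly_regular G (card (pverts G)) r 0 2"
  unfolding strongly_regular_def
proof (intro conjI ballI impI)
  fix u v assume uv: "u \<in> pverts G" "v \<in> pverts G" "u \<noteq> v"
  have "(r + 1) choose 2 = (r choose 2) + r" by (simp add: numeral_2_eq_2)
  then have "card {v \<in> pverts G - {u} - neighbours u. common_neighbours G u v = {}} = 0"
    using card_verts_eq[OF reg uv(1)] n by simp
  then have "{v \<in> pverts G - {u} - neighbours u. common_neighbours G u v = {}} = {}"
    using pair_finite_verts by simp
  then have "v \<in> neighbours u \<or> card (common_neighbours G u v) \<noteq> 0"
    using uv by (auto simp: common_neighbours_eq)
  then show "card (common_neighbours G u v) = (if (u, v) \<in> parcs G then 0 else 2)"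
    using zero_or_two[OF uv] common_neighbours_adjacent[of v u] by (auto simp: neighbours_def)
qed (use reg in \<open>auto intro: pair_graph_axioms\<close>)

lemma sum_card_common_neighbours_square:
  assumes reg: "regular_of_degree G r" and u: "u \<in> pverts G"
  shows "(\<Sum>v\<in>pverts G. card (common_neighbours G u v) ^ 2) = r * r + 2 * (r * (r - 1))"
proof -
  \<comment> \<open>For x in {0, 2} one has x^2 = 2x, so the second moment reduces to the
    first.\<close>
  have "(\<Sum>v\<in>pverts G - {u}. card (common_neighbours G u v) ^ 2)
      = (\<Sum>v\<in>pverts G - {u}. 2 * card (common_neighbours G u v))"
  proof (intro sum.cong refl)
    fix v assume "v \<in> pverts G - {u}"
    then show "card (common_neighbours G u v) ^ 2 = 2 * card (common_neighbours G u v)"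
      using zero_or_two[OF u, of v] by (auto simp: power2_eq_square)
  qed
  then show ?thesis
    using sum.remove[OF pair_finite_verts u, of "\<lambda>v. card (common_neighbours G u v) ^ 2"]
      sum_card_common_neighbours_other[OF assms]
    by (simp add: common_neighbours_self card_neighbours[OF assms] power2_eq_square
        flip: sum_distrib_left)
qed

text \<open>The trace of A^3 counts closed walks of length three, that is, triangles with a starting
  vertex and a direction.\<close>

lemma eigenvalue_power_sum_3: "eigenvalue_power_sum (adjacency_matrix G) 3 = 0"
proof -
  let ?A = "adjacency_matrix G"
  have A: "?A \<in> carrier_mat (card (pverts G)) (card (pverts G))" by (simp add: adjacency_matrix_eq)
  have "?A ^\<^sub>m 3 = ?A * ?A * ?A" using A by (simp add: numeral_3_eq_3)
  also have "\<dots> = vertex_mat (\<lambda>u v. \<Sum>w\<in>pverts G. of_nat (card (common_neighbours G u w)) *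
      (if v \<in> neighbours w then 1 else 0))"
    by (simp add: adjacency_matrix_square) (simp add: adjacency_matrix_eq vertex_mat_mult)
  finally have "mat_trace (?A ^\<^sub>m 3) = (\<Sum>u\<in>pverts G. \<Sum>w\<in>pverts G.
      of_nat (card (common_neighbours G u w)) * (if u \<in> neighbours w then 1 else 0))"
    by (simp add: trace_vertex_mat)
  also have "\<dots> = 0"
    using common_neighbours_adjacent neighbours_commute by (intro sum.neutral ballI) auto
  finally show ?thesis using eigenvalue_power_sum_eq_trace[OF A] by simp
qed

text \<open>By symmetry the trace of (A^2)^2 is the sum of the squared common-neighbour counts, and
  r^2 + 2r(r - 1) = r(3r - 2).\<close>

lemma eigenvalue_power_sum_4:
  assumes reg: "regular_of_degree G r"
  shows "eigenvalue_power_sum (adjacency_matrix G) 4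
    = of_nat (card (pverts G)) * of_nat r * (3 * of_nat r - 2)"
proof -
  let ?A = "adjacency_matrix G"
  let ?c = "\<lambda>u v. card (common_neighbours G u v)"
  have A: "?A \<in> carrier_mat (card (pverts G)) (card (pverts G))" by (simp add: adjacency_matrix_eq)
  have "?A ^\<^sub>m 4 = ?A * ?A * (?A * ?A)"
    using A by (simp add: numeral_eq_Suc assoc_mult_mat[of _ "card (pverts G)" "card (pverts G)"
        _ "card (pverts G)" _ "card (pverts G)"])
  also have "\<dots> = vertex_mat (\<lambda>u v. \<Sum>w\<in>pverts G. of_nat (?c u w) * of_nat (?c w v))"
    by (simp add: adjacency_matrix_square vertex_mat_mult)
  finally have "mat_trace (?A ^\<^sub>m 4)
      = (\<Sum>u\<in>pverts G. \<Sum>w\<in>pverts G. of_nat (?c u w) * of_nat (?c w u))"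
    by (simp add: trace_vertex_mat)
  also have "\<dots> = of_nat (\<Sum>u\<in>pverts G. \<Sum>w\<in>pverts G. ?c u w ^ 2)"
    by (simp add: common_neighbours_eq Int_commute power2_eq_square)
  also have "\<dots> = of_nat (card (pverts G) * (r * r + 2 * (r * (r - 1))))"
    by (simp add: sum_card_common_neighbours_square[OF reg])
  also have "\<dots> = of_nat (card (pverts G)) * of_nat r * (3 * of_nat r - 2)"
    by (cases r) (auto simp: algebra_simps)
  finally show ?thesis using eigenvalue_power_sum_eq_trace[OF A] by simp
qed

end

section \<open>Quadrangles\<close>

text \<open>k(k - 1) = k for k in {0, 2}. Once two opposite vertices of a quadrangle are fixed, this
  counts the ordered choices of the other two.\<close>

lemma card_distinct_pairs:
  assumes "card X \<in> {0, 2}" "finite X"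
  shows "card {(x, y). x \<in> X \<and> y \<in> X \<and> x \<noteq> y} = card X"
proof (cases "X = {}")
  case False
  with assms have "card X = 2" by auto
  then obtain x y where xy: "X = {x, y}" "x \<noteq> y" by (auto simp: card_2_iff)
  then have "{(x, y). x \<in> X \<and> y \<in> X \<and> x \<noteq> y} = {(x, y), (y, x)}" by auto
  then show ?thesis using xy by simp
qed simp

context signed_rectagraph
begin

text \<open>Quadrangles with a starting vertex and a direction, which are easier to count than edge
  sets.\<close>

definition cycle_tuples :: "('a \<times> 'a \<times> 'a \<times> 'a) set" where
  "cycle_tuples = {(a, b, c, d). distinct [a, b, c, d] \<and>
     (a, b) \<in> parcs G \<and> (b, c) \<in> parcs G \<and> (c, d) \<in> parcs G \<and> (d, a) \<in> parcs G}"

definition cycle_edges :: "'a \<times> 'a \<times> 'a \<times> 'a \<Rightarrow> 'a set set" where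
  "cycle_edges = (\<lambda>(a, b, c, d). {{a, b}, {b, c}, {c, d}, {d, a}})"

lemma quadrangles_eq: "quadrangles G = cycle_edges ` cycle_tuples"
  unfolding quadrangles_def cycle_edges_def cycle_tuples_def by (auto simp: image_iff)

lemma card_cycle_tuples:
  assumes reg: "regular_of_degree G r"
  shows "finite cycle_tuples" "card cycle_tuples = card (pverts G) * (r * (r - 1))"
proof -
  let ?P = "\<lambda>a c. {(b, d). b \<in> common_neighbours G a c \<and> d \<in> common_neighbours G a c \<and> b \<noteq> d}"
  \<comment> \<open>The opposite vertices a, c are chosen first; b and d are then an ordered pair of
    distinct common neighbours.\<close>
  let ?S = "SIGMA a:pverts G. SIGMA c:pverts G - {a}. ?P a c"
  let ?f = "\<lambda>(a, c, b, d). (a, b, c, d)"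
  have fin: "finite (common_neighbours G a c)" for a c by (simp add: common_neighbours_eq)
  have finP: "finite (?P a c)" for a c
    using finite_subset[of "?P a c" "common_neighbours G a c \<times> common_neighbours G a c"] fin by auto
  have eq: "cycle_tuples = ?f ` ?S"
  proof (intro equalityI subsetI)
    fix t assume "t \<in> cycle_tuples"
    then obtain a b c d where t: "t = (a, b, c, d)" "distinct [a, b, c, d]"
      "(a, b) \<in> parcs G" "(b, c) \<in> parcs G" "(c, d) \<in> parcs G" "(d, a) \<in> parcs G"
      by (auto simp: cycle_tuples_def)
    then have "(a, c, b, d) \<in> ?S"
      using arc_commute in_arcsD1 by (auto simp: common_neighbours_def)
    then show "t \<in> ?f ` ?S" unfolding t(1) by force
  next
    fix t assume "t \<in> ?f ` ?S"
    then obtain a b c d where t: "t = (a, b, c, d)" and abcd: "a \<noteq> c" "b \<noteq> d"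
      "(a, b) \<in> parcs G" "(c, b) \<in> parcs G" "(a, d) \<in> parcs G" "(c, d) \<in> parcs G"
      by (auto simp: common_neighbours_def)
    then show "t \<in> cycle_tuples"
      using arc_commute no_loops' by (auto simp: cycle_tuples_def)
  qed
  have "finite ?S" using pair_finite_verts finP by (intro finite_SigmaI) auto
  then show "finite cycle_tuples" unfolding eq by simp
  have "card cycle_tuples = card ?S" unfolding eq by (intro card_image) (auto simp: inj_on_def)
  also have "\<dots> = (\<Sum>a\<in>pverts G. \<Sum>c\<in>pverts G - {a}. card (?P a c))"
    using pair_finite_verts finP by (simp add: card_SigmaI)
  also have "\<dots> = (\<Sum>a\<in>pverts G. \<Sum>c\<in>pverts G - {a}. card (common_neighbours G a c))"
    using zero_or_two fin by (intro sum.cong card_distinct_pairs) auto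
  also have "\<dots> = card (pverts G) * (r * (r - 1))"
    using sum_card_common_neighbours_other[OF reg] by simp
  finally show "card cycle_tuples = card (pverts G) * (r * (r - 1))" .
qed

text \<open>The dihedral group of order 8: four rotations and four reflections.\<close>

lemma cycle_edges_fibre:
  assumes "(a, b, c, d) \<in> cycle_tuples"
  shows "{t \<in> cycle_tuples. cycle_edges t = cycle_edges (a, b, c, d)}
    = {(a, b, c, d), (b, c, d, a), (c, d, a, b), (d, a, b, c),
       (d, c, b, a), (c, b, a, d), (b, a, d, c), (a, d, c, b)}" (is "?L = ?R")
proof
  have dist: "distinct [a, b, c, d]" using assms by (simp add: cycle_tuples_def)
  show "?L \<subseteq> ?R"
  proof
    fix t assume t: "t \<in> ?L"
    obtain x y z w where xyzw: "t = (x, y, z, w)" by (cases t)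
    then have d: "distinct [x, y, z, w]" and e: "cycle_edges (x, y, z, w) = cycle_edges (a, b, c, d)"
      using t by (auto simp: cycle_tuples_def)
    \<comment> \<open>The first edge leaves eight choices of (x, y); the next two edges then
      determine z and w.\<close>
    have "{x, y} \<in> cycle_edges (a, b, c, d)" "{y, z} \<in> cycle_edges (a, b, c, d)"
      "{z, w} \<in> cycle_edges (a, b, c, d)"
      unfolding e[symmetric] by (simp_all add: cycle_edges_def)
    then show "t \<in> ?R"
      using d dist unfolding xyzw cycle_edges_def by (auto simp: doubleton_eq_iff)
  qed
  show "?R \<subseteq> ?L"
    using assms arc_commute by (auto simp: cycle_tuples_def cycle_edges_def insert_commute)
qed

lemma card_quadrangles:
  assumes reg: "regular_of_degree G r"
  shows "8 * card (quadrangles G) = card (pverts G) * (r * (r - 1))"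
proof -
  have fibre: "card {t \<in> cycle_tuples. cycle_edges t = Q} = 8" if "Q \<in> cycle_edges ` cycle_tuples" for Q
  proof -
    obtain a b c d where t: "(a, b, c, d) \<in> cycle_tuples" "Q = cycle_edges (a, b, c, d)"
      using \<open>Q \<in> _\<close> by auto
    then have "distinct [a, b, c, d]" by (simp add: cycle_tuples_def)
    then show ?thesis unfolding t(2) cycle_edges_fibre[OF t(1)] by auto
  qed
  have "card cycle_tuples = (\<Sum>Q\<in>cycle_edges ` cycle_tuples. card {t \<in> cycle_tuples. cycle_edges t = Q})"
    using sum.image_gen[OF card_cycle_tuples(1)[OF reg], of "\<lambda>_. 1 :: nat" cycle_edges] by simp
  also have "\<dots> = 8 * card (quadrangles G)" using fibre by (simp add: quadrangles_eq)
  finally show ?thesis using card_cycle_tuples(2)[OF reg] by simp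
qed
end

section \<open>The signed adjacency matrix\<close>

context SR2SE
begin

text \<open>Integer entries are kept because the two-squares argument needs integral determinants
  and characteristic polynomials.\<close>

definition signed_adj :: "'a \<Rightarrow> 'a \<Rightarrow> int" where
  "signed_adj u v = (if v \<in> neighbours u then \<sigma> {u, v} else 0)"

definition signed_square :: "'a \<Rightarrow> 'a \<Rightarrow> int" where
  "signed_square u v = (\<Sum>w\<in>pverts G. signed_adj u w * signed_adj w v)"

lemma signed_adj_commute: "signed_adj u v = signed_adj v u"
  using neighbours_commute by (simp add: signed_adj_def insert_commute)

lemma signed_square_commute: "signed_square u v = signed_square v u"
  unfolding signed_square_def by (subst (1 2) signed_adj_commute) (simp add: mult.commute)

lemma signed_square_self:
  assumes "regular_of_degree G r" "u \<in> pverts G"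
  shows "signed_square u u = int r"
proof -
  have "signed_square u u = (\<Sum>w\<in>pverts G. if w \<in> neighbours u then 1 else 0)"
    unfolding signed_square_def
  proof (intro sum.cong refl)
    fix w
    have "\<sigma> {u, w} \<in> {1, - 1}" if "w \<in> neighbours u"
      using sign that by (simp add: neighbours_def)
    then show "signed_adj u w * signed_adj w u = (if w \<in> neighbours u then 1 else 0)"
      unfolding signed_adj_commute[of w] by (auto simp: signed_adj_def)
  qed
  also have "\<dots> = int (card (pverts G \<inter> neighbours u))"
    using pair_finite_verts by (simp flip: sum.inter_restrict)
  finally show ?thesis using neighbours_subset card_neighbours[OF assms] by (simp add: Int_absorb1)
qed

lemma signed_adjacency_matrix_eq:
  "signed_adjacency_matrix G \<sigma> = vertex_mat (\<lambda>u v. of_int (signed_adj u v))"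
  using vertex_list(3)[OF pair_finite_verts]
  by (auto simp: signed_adjacency_matrix_def vertex_mat_def Let_def neighbours_def signed_adj_def)

lemma signed_power_sums:
  fixes r :: nat
  assumes reg: "regular_of_degree G r"
  defines "n \<equiv> card (pverts G)" and "S \<equiv> signed_adjacency_matrix G \<sigma>"
  shows "eigenvalue_power_sum S 0 = of_nat n" "eigenvalue_power_sum S 1 = 0"
    "eigenvalue_power_sum S 2 = of_nat n * of_nat r"
    "eigenvalue_power_sum S 4 = of_int (\<Sum>u\<in>pverts G. \<Sum>v\<in>pverts G. signed_square u v ^ 2)"
proof -
  have S: "S \<in> carrier_mat n n" by (simp add: S_def n_def signed_adjacency_matrix_eq)
  note tr = eigenvalue_power_sum_eq_trace[OF S]
  have SS: "S * S = vertex_mat (\<lambda>u v. of_int (signed_square u v))"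
    unfolding S_def signed_adjacency_matrix_eq vertex_mat_mult by (simp add: signed_square_def)
  show "eigenvalue_power_sum S 0 = of_nat n" using S by (simp add: tr mat_trace_def)
  have "S ^\<^sub>m 1 = S" using S by simp
  then show "eigenvalue_power_sum S 1 = 0" unfolding tr
    by (simp add: S_def signed_adjacency_matrix_eq trace_vertex_mat signed_adj_def)
  have "S ^\<^sub>m 2 = S * S" using S by (simp add: numeral_2_eq_2)
  then have "eigenvalue_power_sum S 2 = (\<Sum>u\<in>pverts G. of_int (signed_square u u))"
    unfolding tr SS by (simp add: trace_vertex_mat)
  then show "eigenvalue_power_sum S 2 = of_nat n * of_nat r"
    by (simp add: signed_square_self[OF reg] n_def)
  have "S ^\<^sub>m 4 = (S * S) * (S * S)"
    using S by (simp add: numeral_eq_Suc assoc_mult_mat[of _ n n _ n _ n])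
  then have "eigenvalue_power_sum S 4 = (\<Sum>u\<in>pverts G. \<Sum>v\<in>pverts G.
      of_int (signed_square u v) * of_int (signed_square v u))"
    unfolding tr SS by (simp add: vertex_mat_mult trace_vertex_mat)
  then show "eigenvalue_power_sum S 4 = of_int (\<Sum>u\<in>pverts G. \<Sum>v\<in>pverts G. signed_square u v ^ 2)"
    by (simp add: signed_square_commute power2_eq_square)
qed

lemma signed_eigenvalue:
  assumes reg: "regular_of_degree G r"
  obtains \<mu> where "\<mu> ^ 2 = of_nat r" "\<mu> \<noteq> 0" "pverts G \<noteq> {}"
    "card (pverts G) = 2 * Polynomial.order \<mu> (char_poly (signed_adjacency_matrix G \<sigma>))"
    "\<forall>u\<in>pverts G. \<forall>v\<in>pverts G. signed_square u v = (if u = v then int r else 0)"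
proof -
  let ?S = "signed_adjacency_matrix G \<sigma>" and ?n = "card (pverts G)"
  obtain \<mu> where \<mu>: "\<mu> \<noteq> 0" and spec: "spectrum ?S = {\<mu>, - \<mu>}"
    using two_symmetric_eigenvalues by blast
  have S: "?S \<in> carrier_mat ?n ?n" by (simp add: signed_adjacency_matrix_eq)
  have "eigenvalue ?S \<mu>" using spec unfolding spectrum_def by blast
  then have n: "?n > 0" by (rule eigenvalue_imp_nonzero_dim[OF S])
  define a b where "a = Polynomial.order \<mu> (char_poly ?S)"
    and "b = Polynomial.order (- \<mu>) (char_poly ?S)"
  \<comment> \<open>As \<mu> \<noteq> 0, the two points of the spectrum are distinct and the sum
    really has two terms.\<close>
  have pow: "eigenvalue_power_sum ?S k = of_nat a * \<mu> ^ k + of_nat b * (- \<mu>) ^ k" for k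
    using \<mu> by (simp add: eigenvalue_power_sum_def spec a_def b_def)
  note ps = signed_power_sums[OF reg]
  have "(of_nat a :: complex) = of_nat b" using ps(2) \<mu> by (simp add: pow algebra_simps)
  then have ab: "a = b" by simp
  have "(of_nat (a + b) :: complex) = of_nat ?n" using ps(1) by (simp add: pow)
  then have na: "?n = 2 * a" using ab by (simp only: of_nat_eq_iff)
  have "of_nat ?n * \<mu> ^ 2 = of_nat ?n * of_nat r"
    using ps(3) by (simp add: pow na ab)
  then have \<mu>2: "\<mu> ^ 2 = of_nat r" using n by auto
  have "\<mu> ^ 4 = (\<mu> ^ 2) ^ 2" by simp
  then have "eigenvalue_power_sum ?S 4 = of_nat ?n * of_nat r ^ 2"
    unfolding pow using \<mu>2 by (simp add: na ab)
  then have "complex_of_int (\<Sum>u\<in>pverts G. \<Sum>v\<in>pverts G. signed_square u v ^ 2) = of_int (int ?n * int r ^ 2)"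
    using ps(4) by simp
  then have total: "(\<Sum>u\<in>pverts G. \<Sum>v\<in>pverts G. signed_square u v ^ 2) = int ?n * int r ^ 2"
    by (simp only: of_int_eq_iff)
  have "(\<Sum>u\<in>pverts G. \<Sum>v\<in>pverts G. signed_square u v ^ 2)
      = (\<Sum>u\<in>pverts G. int r ^ 2 + (\<Sum>v\<in>pverts G - {u}. signed_square u v ^ 2))"
    using pair_finite_verts by (intro sum.cong refl) (simp add: sum.remove signed_square_self[OF reg])
  \<comment> \<open>The diagonal alone accounts for n r^2, so the off-diagonal squares sum to zero
    and each vanishes.\<close>
  with total have "(\<Sum>u\<in>pverts G. \<Sum>v\<in>pverts G - {u}. signed_square u v ^ 2) = 0"
    by (simp add: sum.distrib)
  then have "signed_square u v ^ 2 = 0" if "u \<in> pverts G" "v \<in> pverts G - {u}" for u v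
    using that pair_finite_verts by (simp add: sum_nonneg_eq_0_iff sum_nonneg)
  then have "\<forall>u\<in>pverts G. \<forall>v\<in>pverts G. signed_square u v = (if u = v then int r else 0)"
    using signed_square_self[OF reg] by auto
  moreover have "pverts G \<noteq> {}" using n by auto
  ultimately show ?thesis using that \<mu>2 \<mu> na unfolding a_def by blast
qed

lemma degree_sum_of_two_squares:
  assumes reg: "regular_of_degree G r" and n: "[card (pverts G) = 2] (mod 4)"
  shows "\<exists>a b. int r = a ^ 2 + b ^ 2"
proof -
  let ?n = "card (pverts G)" and ?S = "vertex_mat signed_adj"
  obtain \<mu> where \<mu>: "\<mu> ^ 2 = of_nat r" "\<mu> \<noteq> 0" and "pverts G \<noteq> {}"
    and order: "?n = 2 * Polynomial.order \<mu> (char_poly (signed_adjacency_matrix G \<sigma>))"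
    and sq: "\<forall>u\<in>pverts G. \<forall>v\<in>pverts G. signed_square u v = (if u = v then int r else 0)"
    using signed_eigenvalue[OF reg] .
  define m where "m = Polynomial.order \<mu> (char_poly (signed_adjacency_matrix G \<sigma>))"
  have n2: "?n = 2 * m" using order by (simp add: m_def)
  have vl: "vertex_list G ! i \<in> pverts G" "vertex_list G ! i = vertex_list G ! j \<longleftrightarrow> i = j"
    if "i < 2 * m" "j < 2 * m" for i j
    using nth_vertex_list_bij that unfolding n2 by (auto simp: bij_betw_def inj_on_def)
  have entry: "?S $$ (i, j) = signed_adj (vertex_list G ! i) (vertex_list G ! j)"
    if "i < 2 * m" "j < 2 * m" for i j using that by (simp add: vertex_mat_def n2)
  show ?thesis
  proof (rule sum_of_two_squares_if_symmetric_square_root)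
    show "?S \<in> carrier_mat (2 * m) (2 * m)" using vertex_mat_carrier n2 by metis
    show "int r > 0" using \<mu> by (cases r) auto
    show "odd m" using n n2 by (auto simp: cong_def elim!: evenE)
    show "\<mu> ^ 2 = of_int (int r)" using \<mu> by simp
    show "Polynomial.order \<mu> (char_poly (map_mat of_int ?S)) = m"
      by (simp add: m_def map_vertex_mat signed_adjacency_matrix_eq)
    show "?S $$ (i, j) = ?S $$ (j, i)" if "i < 2 * m" "j < 2 * m" for i j
      using that by (simp add: entry signed_adj_commute)
    show "(\<Sum>k<2 * m. ?S $$ (i, k) * ?S $$ (k, j)) = (if i = j then int r else 0)"
      if ij: "i < 2 * m" "j < 2 * m" for i j
    proof -
      have "(\<Sum>k<2 * m. ?S $$ (i, k) * ?S $$ (k, j))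
          = signed_square (vertex_list G ! i) (vertex_list G ! j)"
        using ij by (simp add: entry signed_square_def n2 flip: sum_vertex_list)
      then show ?thesis using sq vl(1)[OF ij] vl(1)[OF ij(2,1)] vl(2)[OF ij] by simp
    qed
  qed
qed

end

theorem theorem3p4:
  fixes G :: "'a pair_pre_digraph" and \<sigma> :: "'a set \<Rightarrow> int" and n r :: nat
  assumes "nr_SR2SE G \<sigma> n r"
  shows "(n \<ge> ((r + 1) choose 2) + 1 \<and>
            (n = ((r + 1) choose 2) + 1 \<longrightarrow> strongly_regular G n r 0 2)) \<and>
         real (card (quadrangles G)) = real n / 4 * real (r choose 2) \<and>
         ([n = 2] (mod 4) \<longrightarrow>
            (\<exists>a b :: int. int r = a ^ 2 + b ^ 2) \<and> [int r * (int r - 1) = 0] (mod 4)) \<and>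
         (eigenvalue_power_sum (adjacency_matrix G) 3 = 0 \<and>
          eigenvalue_power_sum (adjacency_matrix G) 4 =
            of_nat n * of_nat r * (3 * of_nat r - 2))"
proof -
  interpret SR2SE G \<sigma> using assms by (simp add: nr_SR2SE_def)
  have n: "card (pverts G) = n" and reg: "regular_of_degree G r"
    using assms by (simp_all add: nr_SR2SE_def)
  \<comment> \<open>The bound on n is a count seen from one vertex; the existence of an eigenvalue
    supplies that vertex.\<close>
  obtain u where u: "u \<in> pverts G" using signed_eigenvalue[OF reg] by blast
  have "n \<ge> ((r + 1) choose 2) + 1" using card_verts_eq[OF reg u] by (simp add: n numeral_2_eq_2)
  moreover have "strongly_regular G n r 0 2" if "n = ((r + 1) choose 2) + 1"
    using strongly_regular_if_card_verts[OF reg] that n by simp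
  moreover have quad: "8 * card (quadrangles G) = n * (r * (r - 1))"
    using card_quadrangles[OF reg] n by simp
  have "real (card (quadrangles G)) = real n / 4 * real (r choose 2)"
  proof -
    have "even (r * (r - 1))" by (cases r) auto
    then have "2 * (r choose 2) = r * (r - 1)" by (simp add: choose_two)
    then have "8 * card (quadrangles G) = 2 * (n * (r choose 2))" using quad by simp
    then show ?thesis by (simp add: field_simps flip: of_nat_mult)
  qed
  moreover have "[int r * (int r - 1) = 0] (mod 4)" if "[n = 2] (mod 4)"
  proof -
    \<comment> \<open>Halving the quadrangle count gives k r(r - 1) = 4q, with q the number of
      quadrangles. Since k is odd, 4 divides r(r - 1).\<close>
    define k where "k = n div 2"
    have k: "n = 2 * k" "odd k" using that unfolding cong_def k_def by presburger+
    then have "k * (r * (r - 1)) = 4 * card (quadrangles G)" using quad by simp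
    then have "4 dvd k * (r * (r - 1))" by simp
    moreover have "coprime (2 ^ 2) k" using k(2) unfolding coprime_power_left_iff by simp
    ultimately have "4 dvd r * (r - 1)" by (simp add: coprime_dvd_mult_right_iff)
    then have "int 4 dvd int (r * (r - 1))" by (simp only: int_dvd_int_iff)
    moreover have "int (r * (r - 1)) = int r * (int r - 1)" by (cases r) (auto simp: algebra_simps)
    ultimately show ?thesis unfolding cong_0_iff by (simp only: of_nat_numeral)
  qed
  ultimately show ?thesis
    using degree_sum_of_two_squares[OF reg] eigenvalue_power_sum_3 eigenvalue_power_sum_4[OF reg] n
    by simp
qed

end
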